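(* Let $a,b$ be integers with $0\le a<b$. There exists a function $f_{a,b}:(0,1]\to[b,b+1]$ with $f_{a,b}(1)=b+1$ such that: (a) if $\alpha\in(0,1)$ is irrational, then $d_{f_{a,b}(\alpha)}(1)=b\,c_\alpha$; (b) if $\alpha=p/q\in(0,1)$ with $p,q$ relatively prime, then $d_{f_{a,b}(\alpha)}(1)=b\,z_{p,q}\,b$, where $c_\alpha$ and $z_{p,q}$ are written over the alphabet $\{a,b\}$.
   Context: For real $\beta>1$, $T_\beta(x)=\beta x\bmod 1$ on $[0,1]$ and the $\beta$-expansion of $1$ is $d_\beta(1)=(x_i)_{i\ge1}$ with $x_i=\lfloor\beta T_\beta^{i-1}(1)\rfloor$ (written as a finite word, trailing zeros omitted, if it ends in $0^\omega$). For coprime $0<p<q$, the word $t'_{p,q}=a'_0\cdots a'_{q-1}$, $a'_i=\lceil (i+1)p/q\rceil-\lceil ip/q\rceil\in\{0,1\}$, factors as $1\,z_{p,q}\,0$, defining the central word $z_{p,q}$. For irrational $\alpha\in(0,1)$, the word $(\lceil\alpha(n+1)\rceil-\lceil\alpha n\rceil)_{n\ge0}$ equals $1\,c_\alpha$, defining the characteristic word $c_\alpha$. "Written over $\{a,b\}$": replace each $0$ by $a$ and each $1$ by $b$. *)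

theory Defs
  imports Complex_Main "HOL-Library.FuncSet" "HOL-Library.Omega_Words_Fun"
begin

datatype 'a fin_inf_word = Finite_word "'a list" | Infinite_word "'a word"

definition beta_transformation :: "real \<Rightarrow> real \<Rightarrow> real" where
  "beta_transformation \<beta> x = frac (\<beta> * x)"

text \<open>Words are indexed from 0 here, so \<open>beta_digit \<beta> i\<close> is $x_{i+1}$.\<close>

definition beta_digit :: "real \<Rightarrow> int word" where
  "beta_digit \<beta> i = \<lfloor>\<beta> * (beta_transformation \<beta> ^^ i) 1\<rfloor>"

definition beta_expansion_of_1 :: "real \<Rightarrow> int fin_inf_word" where
  "beta_expansion_of_1 \<beta> =
     (if \<exists>n. \<forall>i\<ge>n. beta_digit \<beta> i = 0
      then Finite_word (prefix (LEAST n. \<forall>i\<ge>n. beta_digit \<beta> i = 0) (beta_digit \<beta>))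
      else Infinite_word (beta_digit \<beta>))"

text \<open>
  The $\beta$-expansion is meant for $\beta > 1$. The total definition above gives the
  one-letter word $1$ at $\beta = 1$, so an expansion of length at least 2 and leading
  digit at least 1 already forces $\beta > 1$.
\<close>

lemma beta_expansion_of_1_at_1: "beta_expansion_of_1 1 = Finite_word [1]"
proof -
  have T: "(beta_transformation 1 ^^ i) 1 = (if i = 0 then 1 else 0)" for i
    by (induction i) (auto simp: beta_transformation_def)
  have d: "beta_digit 1 i = (if i = 0 then 1 else 0)" for i
    by (simp add: beta_digit_def T)
  have "(\<forall>i\<ge>n. beta_digit 1 i = 0) \<longleftrightarrow> 1 \<le> n" for n
    by (auto simp: d)
  moreover have "(LEAST n::nat. 1 \<le> n) = 1"
    by (rule Least_equality) auto
  ultimately show ?thesis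
    by (auto simp: beta_expansion_of_1_def subsequence_def d)
qed

definition upper_mechanical_word :: "real \<Rightarrow> int word" where
  "upper_mechanical_word \<alpha> n = \<lceil>\<alpha> * real (n + 1)\<rceil> - \<lceil>\<alpha> * real n\<rceil>"

definition upper_christoffel_word :: "nat \<Rightarrow> nat \<Rightarrow> int list" where
  "upper_christoffel_word p q =
     map (\<lambda>i. \<lceil>real (i + 1) * real p / real q\<rceil> - \<lceil>real i * real p / real q\<rceil>) [0..<q]"

definition characteristic_word :: "real \<Rightarrow> int word" where
  "characteristic_word \<alpha> = suffix 1 (upper_mechanical_word \<alpha>)"

definition central_word :: "nat \<Rightarrow> nat \<Rightarrow> int list" where
  "central_word p q = butlast (tl (upper_christoffel_word p q))"

lemma upper_mechanical_word_eq:
  assumes "0 < \<alpha>" "\<alpha> < 1"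
  shows "upper_mechanical_word \<alpha> = [1] \<frown> characteristic_word \<alpha>"
proof
  fix n
  have "\<lceil>\<alpha>\<rceil> = 1" using assms by (simp add: ceiling_eq_iff)
  then show "upper_mechanical_word \<alpha> n = ([1] \<frown> characteristic_word \<alpha>) n"
    by (cases n) (auto simp: conc_def characteristic_word_def upper_mechanical_word_def)
qed

lemma upper_christoffel_word_eq:
  assumes "0 < p" "p < q"
  shows "upper_christoffel_word p q = 1 # central_word p q @ [0]"
proof -
  obtain m where m: "q = Suc (Suc m)"
    using assms by (metis Suc_lessE less_zeroE not0_implies_Suc)
  let ?g = "\<lambda>i. \<lceil>real (i + 1) * real p / real q\<rceil> - \<lceil>real i * real p / real q\<rceil>"
  have first: "?g 0 = 1"
    using assms by (simp add: ceiling_eq_iff)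
  have "real (Suc m) * real p / real q = real p - real p / real q"
    using m assms by (simp add: field_simps)
  moreover have "0 < real p / real q" "real p / real q < 1"
    using assms by auto
  ultimately have "\<lceil>real (Suc m) * real p / real q\<rceil> = int p"
    by (simp add: ceiling_eq_iff)
  moreover have "real (Suc m + 1) * real p / real q = real p"
    using m assms by simp
  ultimately have last: "?g (Suc m) = 0"
    by (metis ceiling_of_nat diff_self)
  have "[0..<Suc m] = 0 # [1..<Suc m]"
    by (simp add: upt_conv_Cons del: upt_Suc)
  then have "[0..<q] = 0 # [1..<Suc m] @ [Suc m]"
    unfolding m by (metis append_Cons le0 upt_Suc_append)
  then have w: "upper_christoffel_word p q = 1 # map ?g [1..<Suc m] @ [0]"
    unfolding upper_christoffel_word_def using first last
    by (simp only: list.map map_append append_Cons)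
  then show ?thesis
    by (simp add: central_word_def)
qed

text \<open>\<open>over a b\<close> rewrites the letters $0, 1$ as $a, b$.\<close>

definition over :: "int \<Rightarrow> int \<Rightarrow> int \<Rightarrow> int" where
  "over a b d = (if d = 0 then a else b)"

end

theory Submission
  imports Defs
begin

text \<open>
  Parry's criterion: if every proper suffix of a bounded sequence \<open>x\<close> of nonnegative integers is
  lexicographically smaller than \<open>x\<close>, and \<open>\<beta> > 1\<close> satisfies \<open>\<Sum>n. x n / \<beta> ^ (n + 1) = 1\<close>, then the
  tails \<open>t n = \<Sum>k. x (n + k) / \<beta> ^ (k + 1)\<close> satisfy \<open>t n < 1\<close> for \<open>n \<ge> 1\<close>, so they are the orbit
  of 1 and \<open>x\<close> is the \<open>\<beta>\<close>-expansion of 1. Such a \<open>\<beta>\<close> between \<open>b\<close> and \<open>b + 1\<close> comes from the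
  intermediate value theorem. For the words at hand the number of 1s in a prefix of length \<open>k \<ge> 1\<close>
  is \<open>\<lfloor>\<alpha> k\<rfloor> + 1\<close>, while a factor of length \<open>k\<close> starting later at \<open>n\<close> has
  \<open>\<lfloor>\<alpha> (n + k)\<rfloor> - \<lfloor>\<alpha> n\<rfloor> \<le> \<lfloor>\<alpha> k\<rfloor> + 1\<close> of them, which gives the lexicographic condition.
\<close>

section \<open>Parry's criterion for the expansion of 1\<close>

lemma summable_bounded_digits:
  fixes x :: "nat \<Rightarrow> int" and y :: real
  assumes "\<And>n. 0 \<le> x n" and "\<And>n. x n \<le> B" and "0 \<le> y" and "y < 1"
  shows "summable (\<lambda>n. real_of_int (x n) * y ^ n)"
proof (rule summable_comparison_test')
  show "summable (\<lambda>n. real_of_int B * y ^ n)"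
    using assms by (intro summable_mult summable_geometric) auto
  show "norm (real_of_int (x n) * y ^ n) \<le> real_of_int B * y ^ n" for n
    using assms by (simp add: abs_mult mult_right_mono)
qed

text \<open>Since \<open>t (Suc n)\<close> lies in [0, 1), the recursion splits
  \<open>\<beta> * t n\<close> into its integer and fractional parts, which forces \<open>t\<close>
  to be the orbit of 1.\<close>

lemma beta_digit_eqI:
  fixes x t :: "nat \<Rightarrow> _"
  assumes t0: "t 0 = 1" and step: "\<And>n. \<beta> * t n = real_of_int (x n) + t (Suc n)"
    and tail: "\<And>n. 0 \<le> t (Suc n)" "\<And>n. t (Suc n) < 1"
  shows "beta_digit \<beta> = x"
proof
  have fl: "\<lfloor>\<beta> * t n\<rfloor> = x n" for n
    using tail[of n] by (simp add: step floor_eq_iff)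
  have "(beta_transformation \<beta> ^^ n) 1 = t n" for n
  proof (induction n)
    case (Suc n)
    then show ?case
      using fl[of n] by (simp add: beta_transformation_def frac_def step)
  qed (simp add: t0)
  then show "beta_digit \<beta> n = x n" for n
    by (simp add: beta_digit_def fl)
qed

text \<open>The lexicographic condition magnifies an excess of a tail over 1: it reappears in a
  later tail multiplied by at least \<beta>. The tails have a common bound, so no excess exists;
  equality is excluded separately.\<close>

theorem parry_beta_digit:
  fixes x :: "nat \<Rightarrow> int"
  assumes \<beta>: "1 < \<beta>" and nonneg: "\<And>n. 0 \<le> x n" and bounded: "\<And>n. x n \<le> B"
    and one: "(\<Sum>n. real_of_int (x n) * (1 / \<beta>) ^ Suc n) = 1"
    and lex: "\<And>n. 0 < n \<Longrightarrow> \<exists>k. (\<forall>j<k. x (n + j) = x j) \<and> x (n + k) < x k"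
  shows "beta_digit \<beta> = x"
proof -
  define t where "t n = (\<Sum>k. real_of_int (x (n + k)) * (1 / \<beta>) ^ Suc k)" for n
  have y: "0 < 1 / \<beta>" "1 / \<beta> < 1" using \<beta> by auto
  have summ0: "summable (\<lambda>k. real_of_int (x (n + k)) * (1 / \<beta>) ^ k)" for n
    using y nonneg bounded by (intro summable_bounded_digits[where B = B]) auto
  have summ: "summable (\<lambda>k. real_of_int (x (n + k)) * (1 / \<beta>) ^ Suc k)" for n
    using summable_mult[OF summ0, of "1 / \<beta>" n] by (simp add: mult_ac)
  have t0: "t 0 = 1" using one by (simp add: t_def)
  have tnn: "0 \<le> t n" for n
    unfolding t_def using y nonneg by (intro suminf_nonneg[OF summ]) auto
  have step: "\<beta> * t n = real_of_int (x n) + t (Suc n)" for n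
  proof -
    have "\<beta> * t n = (\<Sum>k. real_of_int (x (n + k)) * (1 / \<beta>) ^ k)"
      unfolding t_def using \<beta> by (subst suminf_mult[OF summ, symmetric]) (auto intro!: suminf_cong)
    also have "\<dots> = real_of_int (x n) + t (Suc n)"
      unfolding t_def using suminf_split_head[OF summ0[of n]] by simp
    finally show ?thesis .
  qed
  define C where "C = (\<Sum>k. real_of_int B * (1 / \<beta>) ^ Suc k)"
  have summB: "summable (\<lambda>k. real_of_int B * (1 / \<beta>) ^ Suc k)"
    using y summable_mult[OF summable_geometric[of "1 / \<beta>"], of "real_of_int B / \<beta>"] by (simp add: mult_ac)
  have tC: "t n \<le> C" for n
    unfolding t_def C_def using y bounded
    by (intro suminf_le[OF _ summ summB]) (auto intro!: mult_right_mono simp del: power_Suc)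
  have C0: "0 \<le> C" using tnn[of 0] tC[of 0] by linarith
  \<comment> \<open>Equal digits cancel in \<open>step\<close>, so each of them just multiplies the
    difference of the two tails by \<beta>.\<close>
  have agree: "\<beta> ^ k * (t n - t 0) = t (n + k) - t k" if "\<forall>j<k. x (n + j) = x j" for n k
    using that
  proof (induction k)
    case (Suc k)
    then have "\<beta> ^ Suc k * (t n - t 0) = \<beta> * (t (n + k) - t k)"
      by (simp add: mult.assoc)
    also have "\<dots> = t (n + Suc k) - t (Suc k)"
      using step[of "n + k"] step[of k] Suc.prems by (simp add: right_diff_distrib)
    finally show ?case .
  qed simp
  \<comment> \<open>At the first difference the digit drops, being an integer, by at least 1; this
    supplies the \<open>- 1\<close> on the right.\<close>
  have key: "\<exists>k. \<beta> ^ Suc k * (t n - 1) \<le> t (n + Suc k) - 1 - t (Suc k)" if n: "0 < n" for n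
  proof -
    obtain k where k: "\<forall>j<k. x (n + j) = x j" "x (n + k) < x k" using lex[OF n] by blast
    have "\<beta> ^ Suc k * (t n - 1) = \<beta> * (t (n + k) - t k)"
      using agree[OF k(1)] by (simp add: t0 mult.assoc)
    also have "\<dots> = real_of_int (x (n + k)) - real_of_int (x k) + t (n + Suc k) - t (Suc k)"
      using step[of "n + k"] step[of k] by (simp add: right_diff_distrib)
    also have "\<dots> \<le> t (n + Suc k) - 1 - t (Suc k)" using k(2) by linarith
    finally show ?thesis by blast
  qed
  \<comment> \<open>The excess moves on to the tail at \<open>n + Suc k\<close>, hence the induction
    for all \<open>n\<close> at once. As \<open>k\<close> is not controlled, only one factor of
    \<open>\<beta> ^ Suc k\<close> is kept.\<close>
  have contract: "t n - 1 \<le> C * (1 / \<beta>) ^ N" for n N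
  proof (induction N arbitrary: n)
    case 0
    show ?case using tC[of n] by simp
  next
    case (Suc N)
    show ?case
    proof (cases "t n \<le> 1")
      case True
      moreover have "0 \<le> C * (1 / \<beta>) ^ Suc N" using C0 y by simp
      ultimately show ?thesis by linarith
    next
      case False
      then have "0 < n" using t0 by (cases n) auto
      then obtain k where "\<beta> ^ Suc k * (t n - 1) \<le> t (n + Suc k) - 1 - t (Suc k)"
        using key by blast
      also have "\<dots> \<le> C * (1 / \<beta>) ^ N" using Suc.IH[of "n + Suc k"] tnn[of "Suc k"] by linarith
      finally have "\<beta> ^ Suc k * (t n - 1) \<le> C * (1 / \<beta>) ^ N" .
      moreover have "\<beta> * (t n - 1) \<le> \<beta> ^ Suc k * (t n - 1)"
        using \<beta> False by (intro mult_right_mono self_le_power) auto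
      ultimately have "\<beta> * (t n - 1) \<le> C * (1 / \<beta>) ^ N" by linarith
      then show ?thesis using \<beta> by (simp add: field_simps)
    qed
  qed
  have le1: "t n \<le> 1" for n
  proof -
    have "(\<lambda>N. C * (1 / \<beta>) ^ N) \<longlonglongrightarrow> C * 0"
      using y by (intro tendsto_mult tendsto_const LIMSEQ_power_zero) auto
    then have "t n - 1 \<le> C * 0"
      by (rule LIMSEQ_le_const) (use contract in blast)
    then show ?thesis by simp
  qed
  \<comment> \<open>Equality would force \<open>t (Suc k) = 0\<close> and
    \<open>t (n + Suc k) = 1\<close>; but a vanishing tail has only zero digits, and the later tail
    consists of some of them.\<close>
  have lt1: "t n < 1" if n: "0 < n" for n
  proof (rule ccontr)
    assume "\<not> t n < 1"
    then have "t n = 1" using le1[of n] by linarith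
    then obtain k where k: "0 \<le> t (n + Suc k) - 1 - t (Suc k)"
      using key[OF n] by auto
    then have tk: "t (Suc k) = 0" "t (n + Suc k) = 1"
      using le1[of "n + Suc k"] tnn[of "Suc k"] by linarith+
    then have "\<forall>j. real_of_int (x (Suc k + j)) * (1 / \<beta>) ^ Suc j = 0"
      unfolding t_def using y nonneg by (subst (asm) suminf_eq_zero_iff[OF summ]) auto
    then have "x (Suc k + j) = 0" for j using \<beta> by auto
    from this[of "n + _"] have "x (n + Suc k + j) = 0" for j by (simp add: add_ac)
    then have "t (n + Suc k) = 0" unfolding t_def by simp
    then show False using tk by simp
  qed
  show ?thesis
    by (rule beta_digit_eqI[of t]) (use t0 step tnn lt1 in auto)
qed

section \<open>Solving for the base\<close>

text \<open>Put \<open>y = 1 / \<beta>\<close>. At \<open>y1\<close> even the constant digits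
  \<open>b\<close> sum to 1, so the value there is at most 1; at \<open>y0\<close> the digits at 0
  and \<open>m\<close> alone already reach 1.\<close>

lemma ex_base_for_digits:
  fixes x :: "nat \<Rightarrow> int" and b :: int
  assumes nonneg: "\<And>n. 0 \<le> x n" and bounded: "\<And>n. x n \<le> b"
    and x0: "x 0 = b" and b: "0 < b" and m: "0 < m" "0 < x m"
  obtains \<beta> where "real_of_int b < \<beta>" "\<beta> \<le> real_of_int b + 1"
    "(\<Sum>n. real_of_int (x n) * (1 / \<beta>) ^ Suc n) = 1"
proof -
  define y1 where "y1 = 1 / (real_of_int b + 1)"
  have y1: "0 < y1" "y1 < 1" "real_of_int b * y1 + y1 = 1"
    using b by (auto simp: y1_def field_simps)
  have y1b: "y1 \<le> 1 / real_of_int b" using b by (simp add: y1_def field_simps)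
  \<comment> \<open>The endpoint \<open>1 / b\<close> would not yield the strict bound
    \<open>b < \<beta>\<close>, and for \<open>b = 1\<close> it is no longer below 1. The extra term
    at \<open>m\<close> gives a root strictly below both.\<close>
  have "\<exists>y0\<ge>y1. y0 \<le> 1 / real_of_int b \<and> real_of_int b * y0 + y0 ^ Suc m = 1"
  proof (rule IVT')
    have "y1 ^ Suc m \<le> y1" using y1 by (simp add: power_le_one mult_left_le)
    then show "real_of_int b * y1 + y1 ^ Suc m \<le> 1" using y1 by linarith
    show "1 \<le> real_of_int b * (1 / real_of_int b) + (1 / real_of_int b) ^ Suc m"
      using b by simp
  qed (use y1b in \<open>auto intro!: continuous_intros\<close>)
  then obtain y0 where y0: "y1 \<le> y0" "real_of_int b * y0 + y0 ^ Suc m = 1" by blast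
  have y0b: "real_of_int b * y0 < 1" using y0 y1 zero_less_power[of y0 "Suc m"] by linarith
  have "1 * y0 \<le> real_of_int b * y0" using b y0 y1 by (intro mult_right_mono) auto
  then have y01: "y0 < 1" using y0b by linarith
  define G where "G y = (\<Sum>n. real_of_int (x n) * y ^ n)" for y :: real
  have summ: "summable (\<lambda>n. real_of_int (x n) * y ^ n)" if "0 \<le> y" "y < 1" for y
    using that nonneg bounded by (intro summable_bounded_digits[where B = b]) auto
  have G: "y * G y = (\<Sum>n. real_of_int (x n) * y ^ Suc n)" if "0 \<le> y" "y < 1" for y
    unfolding G_def by (subst suminf_mult[OF summ[OF that], symmetric]) (simp add: mult_ac)
  have "\<exists>y\<ge>y1. y \<le> y0 \<and> y * G y = 1"
  proof (rule IVT')
    have "G y1 \<le> (\<Sum>n. real_of_int b * y1 ^ n)"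
      unfolding G_def using y1 bounded
      by (intro suminf_le summ summable_mult summable_geometric mult_right_mono) auto
    also have "\<dots> = real_of_int b * (1 / (1 - y1))"
      using y1 by (simp add: suminf_mult suminf_geometric summable_geometric)
    also have "1 - y1 = real_of_int b * y1" using y1 by linarith
    finally show "y1 * G y1 \<le> 1" using y1 b by (simp add: field_simps)
    have "(\<Sum>n\<in>{0, m}. real_of_int (x n) * y0 ^ n) \<le> G y0"
      unfolding G_def using y0 y01 y1 nonneg by (intro sum_le_suminf summ) auto
    then have "real_of_int b + real_of_int (x m) * y0 ^ m \<le> G y0" using m x0 by simp
    moreover have "1 * y0 ^ m \<le> real_of_int (x m) * y0 ^ m"
      using m y0 y1 by (intro mult_right_mono) auto
    ultimately have "real_of_int b + y0 ^ m \<le> G y0" by linarith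
    then have "y0 * (real_of_int b + y0 ^ m) \<le> y0 * G y0" using y0 y1 by (intro mult_left_mono) auto
    then show "1 \<le> y0 * G y0" using y0 by (simp add: algebra_simps)
    \<comment> \<open>The midpoint of \<open>y0\<close> and 1 is a point of convergence beyond
      \<open>y0\<close>, so the power series is continuous up to \<open>y0\<close>.\<close>
    have "isCont G y" if "y1 \<le> y" "y \<le> y0" for y
      unfolding G_def using that y1 y01
      by (intro isCont_powser[of _ "(y0 + 1) / 2"] summ) auto
    then show "continuous_on {y1..y0} (\<lambda>y. y * G y)"
      by (intro continuous_intros continuous_at_imp_continuous_on) auto
  qed (use y0 in auto)
  then obtain y where y: "y1 \<le> y" "y \<le> y0" "y * G y = 1" by blast
  have "0 < y" using y y1 by linarith
  have "real_of_int b * y \<le> real_of_int b * y0" using y b by (intro mult_left_mono) auto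
  then have "real_of_int b * y < 1" using y0b by linarith
  then have "real_of_int b < 1 / y" using \<open>0 < y\<close> by (simp add: field_simps)
  moreover have "1 / y \<le> real_of_int b + 1"
    using \<open>0 < y\<close> y(1) b by (simp add: y1_def field_simps)
  moreover have "(\<Sum>n. real_of_int (x n) * (1 / (1 / y)) ^ Suc n) = 1"
    using G[of y] y y01 \<open>0 < y\<close> by simp
  ultimately show ?thesis using that by blast
qed

lemma ex_beta_digit_eq:
  fixes x :: "nat \<Rightarrow> int" and b :: int
  assumes "\<And>n. 0 \<le> x n" and "\<And>n. x n \<le> b" and "x 0 = b" and "0 < b"
    and "0 < m" and "0 < x m"
    and "\<And>n. 0 < n \<Longrightarrow> \<exists>k. (\<forall>j<k. x (n + j) = x j) \<and> x (n + k) < x k"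
  shows "\<exists>\<beta>\<in>{real_of_int b..real_of_int b + 1}. beta_digit \<beta> = x"
proof -
  obtain \<beta> where \<beta>: "real_of_int b < \<beta>" "\<beta> \<le> real_of_int b + 1"
    "(\<Sum>n. real_of_int (x n) * (1 / \<beta>) ^ Suc n) = 1"
    using ex_base_for_digits[of x b m] assms by metis
  have "1 < \<beta>" using \<beta>(1) \<open>0 < b\<close> by linarith
  then have "beta_digit \<beta> = x" using assms \<beta>(3) by (intro parry_beta_digit[where B = b]) auto
  then show ?thesis using \<beta> by auto
qed

section \<open>Counting letters in Sturmian words\<close>

text \<open>
  The letters of \<open>1 c\<^sub>\<alpha>\<close> for irrational \<open>\<alpha>\<close>; for \<open>\<alpha> = p / q\<close> the first \<open>q\<close> letters form
  \<open>1 z 1\<close> rather than \<open>1 z 0\<close>, because the floor jumps on reaching the integer \<open>\<alpha> q = p\<close>.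
\<close>

definition sturmian_letter :: "real \<Rightarrow> nat \<Rightarrow> int" where
  "sturmian_letter \<alpha> n =
     (if n = 0 then 1 else \<lfloor>\<alpha> * real (Suc n)\<rfloor> - \<lfloor>\<alpha> * real n\<rfloor>)"

lemma sturmian_letter_cases:
  assumes "0 < \<alpha>" "\<alpha> < 1"
  shows "sturmian_letter \<alpha> n = 0 \<or> sturmian_letter \<alpha> n = 1"
proof -
  have "\<alpha> * real (Suc n) = \<alpha> * real n + \<alpha>" by (simp add: algebra_simps)
  then have "\<lfloor>\<alpha> * real n\<rfloor> \<le> \<lfloor>\<alpha> * real (Suc n)\<rfloor>" "\<lfloor>\<alpha> * real (Suc n)\<rfloor> \<le> \<lfloor>\<alpha> * real n\<rfloor> + 1"
    using assms by linarith+
  then show ?thesis by (auto simp: sturmian_letter_def)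
qed

lemma sum_sturmian_letter_shift:
  assumes "0 < n"
  shows "(\<Sum>i<k. sturmian_letter \<alpha> (n + i)) = \<lfloor>\<alpha> * real (n + k)\<rfloor> - \<lfloor>\<alpha> * real n\<rfloor>"
  using assms by (induction k) (auto simp: sturmian_letter_def)

text \<open>The floors telescope from index 1 on; the letter 1 put at index 0, where the floor
  difference would be 0, is the extra summand.\<close>

lemma sum_sturmian_letter:
  assumes "0 < \<alpha>" "\<alpha> < 1"
  shows "(\<Sum>i<Suc k. sturmian_letter \<alpha> i) = \<lfloor>\<alpha> * real (Suc k)\<rfloor> + 1"
proof -
  have "\<lfloor>\<alpha>\<rfloor> = 0" using assms by (simp add: floor_eq_iff)
  then show ?thesis
    using sum_sturmian_letter_shift[where n = 1 and k = k and \<alpha> = \<alpha>]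
    by (simp add: sum.lessThan_Suc_shift sturmian_letter_def del: sum.lessThan_Suc)
qed

text \<open>Through position \<open>k\<close> the later factor has at most as many 1s as the prefix;
  cancelling the equal letters leaves this inequality at \<open>k\<close> alone.\<close>

lemma sturmian_letter_first_difference:
  assumes \<alpha>: "0 < \<alpha>" "\<alpha> < 1" and n: "0 < n"
    and eq: "\<forall>j<k. sturmian_letter \<alpha> (n + j) = sturmian_letter \<alpha> j"
    and neq: "sturmian_letter \<alpha> (n + k) \<noteq> sturmian_letter \<alpha> k"
  shows "sturmian_letter \<alpha> (n + k) < sturmian_letter \<alpha> k"
proof -
  have "\<alpha> * real (n + Suc k) = \<alpha> * real n + \<alpha> * real (Suc k)" by (simp add: algebra_simps)
  then have "\<lfloor>\<alpha> * real (n + Suc k)\<rfloor> - \<lfloor>\<alpha> * real n\<rfloor> \<le> \<lfloor>\<alpha> * real (Suc k)\<rfloor> + 1"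
    by linarith
  then have "(\<Sum>i<Suc k. sturmian_letter \<alpha> (n + i)) \<le> (\<Sum>i<Suc k. sturmian_letter \<alpha> i)"
    by (simp only: sum_sturmian_letter_shift[OF n] sum_sturmian_letter[OF \<alpha>])
  then show ?thesis using eq neq by simp
qed

text \<open>If only 0s remained, \<open>\<lfloor>\<alpha> * n\<rfloor>\<close> would stop
  growing.\<close>

lemma sturmian_letter_infinitely_often_1:
  assumes \<alpha>: "0 < \<alpha>" "\<alpha> < 1"
  shows "\<exists>i\<ge>n. sturmian_letter \<alpha> i = 1"
proof (rule ccontr)
  assume "\<not> ?thesis"
  then have 0: "sturmian_letter \<alpha> i = 0" if "i \<ge> n" for i
    using sturmian_letter_cases[OF \<alpha>, of i] that by auto
  obtain k where k: "1 < real k * \<alpha>" using ex_less_of_nat_mult[OF \<alpha>(1)] by blast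
  have "(\<Sum>i<k. sturmian_letter \<alpha> (Suc n + i)) = 0" by (simp add: 0)
  then have "\<lfloor>\<alpha> * real (Suc n + k)\<rfloor> = \<lfloor>\<alpha> * real (Suc n)\<rfloor>"
    using sum_sturmian_letter_shift[where n = "Suc n" and k = k and \<alpha> = \<alpha>] by simp
  moreover have "\<alpha> * real (Suc n + k) = \<alpha> * real (Suc n) + real k * \<alpha>" by (simp add: algebra_simps)
  ultimately show False using k by linarith
qed

text \<open>Invariance under the shift by \<open>n\<close> would make the 1s accumulate at the rate
  \<open>c / n\<close>, which exceeds \<alpha>; the gap between the two counts then grows without
  bound, whereas a floor is off by less than 1.\<close>

lemma sturmian_letter_aperiodic:
  assumes \<alpha>: "0 < \<alpha>" "\<alpha> < 1" and irr: "\<alpha> \<notin> \<rat>" and n: "0 < n"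
  shows "\<exists>k. sturmian_letter \<alpha> (n + k) \<noteq> sturmian_letter \<alpha> k"
proof (rule ccontr)
  assume "\<not> ?thesis"
  then have eq: "sturmian_letter \<alpha> (n + k) = sturmian_letter \<alpha> k" for k by blast
  \<comment> \<open>The number of 1s among the first \<open>n\<close> letters.\<close>
  define c where "c = \<lfloor>\<alpha> * real n\<rfloor> + 1"
  have shift: "\<lfloor>\<alpha> * real (n + Suc k)\<rfloor> = \<lfloor>\<alpha> * real (Suc k)\<rfloor> + c" for k
    using sum_sturmian_letter_shift[OF n, where k = "Suc k" and \<alpha> = \<alpha>] sum_sturmian_letter[OF \<alpha>, of k]
    unfolding eq c_def by linarith
  have mult: "\<lfloor>\<alpha> * real (Suc k * n)\<rfloor> = int (Suc k) * c - 1" for k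
  proof (induction k)
    case (Suc k)
    obtain l where l: "Suc k * n = Suc l" using n by (cases "Suc k * n") auto
    have "Suc (Suc k) * n = n + Suc l" unfolding l[symmetric] by simp
    then have "\<lfloor>\<alpha> * real (Suc (Suc k) * n)\<rfloor> = \<lfloor>\<alpha> * real (Suc k * n)\<rfloor> + c"
      using shift[of l] l by simp
    then show ?case using Suc.IH by (simp add: algebra_simps)
  qed (simp add: c_def)
  define d where "d = real_of_int c - \<alpha> * real n"
  have "\<alpha> * real n \<noteq> real_of_int c"
  proof
    assume "\<alpha> * real n = real_of_int c"
    then have "\<alpha> = real_of_int c / real n" using n by (simp add: field_simps)
    then show False using irr by simp
  qed
  then have "0 < d" unfolding d_def c_def by linarith
  then obtain k where k: "1 < real k * d" using ex_less_of_nat_mult by blast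
  have "real k * d \<le> real (Suc k) * d" using \<open>0 < d\<close> by (intro mult_right_mono) auto
  with k have "1 < real (Suc k) * d" by linarith
  moreover have "real (Suc k) * d = real_of_int (int (Suc k) * c) - \<alpha> * real (Suc k * n)"
    unfolding d_def by (simp add: algebra_simps)
  ultimately show False using mult[of k] by linarith
qed

section \<open>Bases for irrational and rational slopes\<close>

text \<open>Off the integers the ceiling is the floor plus 1, and the two added 1s cancel. At index
  0 both sides are 1.\<close>

lemma upper_mechanical_eq_sturmian_letter:
  assumes \<alpha>: "0 < \<alpha>" "\<alpha> < 1"
    and "n = 0 \<or> \<alpha> * real n \<notin> \<int> \<and> \<alpha> * real (Suc n) \<notin> \<int>"
  shows "upper_mechanical_word \<alpha> n = sturmian_letter \<alpha> n"
proof (cases "n = 0")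
  case True
  have "\<lceil>\<alpha>\<rceil> = 1" using \<alpha> by (simp add: ceiling_eq_iff)
  then show ?thesis using True by (simp add: upper_mechanical_word_def sturmian_letter_def)
next
  case False
  have "\<lceil>r\<rceil> = \<lfloor>r\<rfloor> + 1" if "r \<notin> \<int>" for r :: real
    using that by (metis Ints_of_int ceiling_altdef)
  then show ?thesis
    using False assms(3) by (simp add: upper_mechanical_word_def sturmian_letter_def)
qed

lemma ex_beta_irrational:
  fixes a b :: int
  assumes a: "0 \<le> a" and b: "a < b" and \<alpha>: "0 < \<alpha>" "\<alpha> < 1" "\<alpha> \<notin> \<rat>"
  shows "\<exists>\<beta>\<in>{real_of_int b..real_of_int b + 1}. beta_expansion_of_1 \<beta> =
    Infinite_word ([b] \<frown> (over a b \<circ> characteristic_word \<alpha>))"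
proof -
  have nonint: "\<alpha> * real n \<notin> \<int>" if n: "0 < n" for n
  proof
    assume "\<alpha> * real n \<in> \<int>"
    then have "\<alpha> * real n / real n \<in> \<rat>" by (intro Rats_divide) (auto elim: Ints_cases)
    then show False using n \<alpha> by simp
  qed
  define x where "x = [b] \<frown> (over a b \<circ> characteristic_word \<alpha>)"
  have "[1] \<frown> characteristic_word \<alpha> = sturmian_letter \<alpha>"
  proof
    show "([1] \<frown> characteristic_word \<alpha>) n = sturmian_letter \<alpha> n" for n
      unfolding upper_mechanical_word_eq[OF \<alpha>(1,2), symmetric]
      by (auto intro!: upper_mechanical_eq_sturmian_letter \<alpha> nonint simp del: of_nat_Suc)
  qed
  then have "sturmian_letter \<alpha> n = ([1] \<frown> characteristic_word \<alpha>) n" for n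
    by simp
  then have x: "x n = over a b (sturmian_letter \<alpha> n)" for n
    unfolding x_def by (simp add: conc_def over_def)
  \<comment> \<open>Used twice: it supplies the second positive digit that fixes the base, and it
    rules out the finite branch of \<open>beta_expansion_of_1\<close>.\<close>
  have pos: "\<exists>i\<ge>n. 0 < x i" for n
    using sturmian_letter_infinitely_often_1[OF \<alpha>(1,2), of n] a b by (auto simp: x over_def)
  obtain m where m: "0 < m" "0 < x m" using pos[of 1] by (metis One_nat_def Suc_le_eq)
  have "\<exists>k. (\<forall>j<k. x (n + j) = x j) \<and> x (n + k) < x k" if n: "0 < n" for n
  proof -
    define k where "k = (LEAST k. sturmian_letter \<alpha> (n + k) \<noteq> sturmian_letter \<alpha> k)"
    have neq: "sturmian_letter \<alpha> (n + k) \<noteq> sturmian_letter \<alpha> k"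
      unfolding k_def using sturmian_letter_aperiodic[OF \<alpha> n] by (rule LeastI_ex)
    have eq: "\<forall>j<k. sturmian_letter \<alpha> (n + j) = sturmian_letter \<alpha> j"
      unfolding k_def using not_less_Least by blast
    have "sturmian_letter \<alpha> (n + k) < sturmian_letter \<alpha> k"
      using sturmian_letter_first_difference[OF \<alpha>(1,2) n eq neq] .
    then have "x (n + k) < x k"
      using sturmian_letter_cases[OF \<alpha>(1,2), of k] sturmian_letter_cases[OF \<alpha>(1,2), of "n + k"] b
      by (auto simp: x over_def)
    then show ?thesis using eq by (intro exI[of _ k]) (simp add: x)
  qed
  then have "\<exists>\<beta>\<in>{real_of_int b..real_of_int b + 1}. beta_digit \<beta> = x"
    using a b m by (intro ex_beta_digit_eq) (auto simp: x over_def sturmian_letter_def)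
  then obtain \<beta> where \<beta>: "\<beta> \<in> {real_of_int b..real_of_int b + 1}" "beta_digit \<beta> = x" by blast
  have "\<not> (\<exists>n. \<forall>i\<ge>n. x i = 0)" using pos by (metis less_irrefl)
  then have "beta_expansion_of_1 \<beta> = Infinite_word x" by (simp add: beta_expansion_of_1_def \<beta>)
  then show ?thesis using \<beta>(1) unfolding x_def by blast
qed

lemma ex_beta_rational:
  fixes a b :: int
  assumes a: "0 \<le> a" and b: "a < b" and pq: "0 < p" "p < q" "coprime p q"
  shows "\<exists>\<beta>\<in>{real_of_int b..real_of_int b + 1}. beta_expansion_of_1 \<beta> =
    Finite_word ([b] @ map (over a b) (central_word p q) @ [b])"
proof -
  define \<alpha> where "\<alpha> = real p / real q"
  have \<alpha>: "0 < \<alpha>" "\<alpha> < 1" using pq by (auto simp: \<alpha>_def)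
  obtain m where m: "q = Suc m" "0 < m" using pq by (cases q) auto
  have nonint: "\<alpha> * real n \<notin> \<int>" if n: "0 < n" "n < q" for n
  proof
    assume "\<alpha> * real n \<in> \<int>"
    then obtain z where "real p * real n / real q = real_of_int z" by (auto simp: \<alpha>_def elim: Ints_cases)
    then have "real_of_int (int p * int n) = real_of_int (z * int q)" using pq by (simp add: field_simps)
    then have "int p * int n = z * int q" by linarith
    then have "int q dvd int p * int n" by simp
    then have "q dvd p * n" by (metis of_nat_dvd_iff of_nat_mult)
    then have "q dvd n" using pq(3) by (metis coprime_commute coprime_dvd_mult_right_iff)
    then show False using n by (auto dest: dvd_imp_le)
  qed
  have last: "sturmian_letter \<alpha> m = 1"
  proof -
    have "\<alpha> * real (Suc m) = real_of_int (int p)" using m pq by (simp add: \<alpha>_def)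
    moreover have "\<alpha> * real m = \<alpha> * real (Suc m) - \<alpha>" by (simp add: algebra_simps)
    ultimately have "\<lfloor>\<alpha> * real (Suc m)\<rfloor> = int p" "\<lfloor>\<alpha> * real m\<rfloor> = int p - 1"
      using \<alpha> by linarith+
    then show ?thesis using m by (simp add: sturmian_letter_def)
  qed
  \<comment> \<open>A finite expansion stands for its word padded by zeros. The padding is the digit
    0 even when \<open>a > 0\<close>, so it is kept apart from the letter \<open>a\<close>.\<close>
  define x where "x n = (if n < q then over a b (sturmian_letter \<alpha> n) else 0)" for n
  have xm: "x m = b" using last m by (simp add: x_def over_def)
  have nonneg: "0 \<le> x n" for n using a b by (simp add: x_def over_def)
  have lex: "\<exists>k. (\<forall>j<k. x (n + j) = x j) \<and> x (n + k) < x k" if n: "0 < n" for n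
  proof -
    \<comment> \<open>Position \<open>n + m\<close> lies in the padding, while
      \<open>x m = b > 0\<close>; so a first difference exists.\<close>
    have "x (n + m) \<noteq> x m" using n m a b xm by (simp add: x_def)
    define k where "k = (LEAST k. x (n + k) \<noteq> x k)"
    have neq: "x (n + k) \<noteq> x k"
      unfolding k_def using \<open>x (n + m) \<noteq> x m\<close> by (rule LeastI)
    have eq: "\<forall>j<k. x (n + j) = x j" unfolding k_def using not_less_Least by blast
    have "x (n + k) < x k"
    \<comment> \<open>Past the end the shifted digit is 0, and a nonnegative digit different from it
      is larger. Inside the word the Sturmian comparison applies, as \<open>over a b\<close> is
      increasing on 0 and 1.\<close>
    proof (cases "n + k < q")
      case False
      then have "x (n + k) = 0" by (simp add: x_def)
      then show ?thesis using neq nonneg[of k] by simp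
    next
      case True
      have letter: "x i = x j \<longleftrightarrow> sturmian_letter \<alpha> i = sturmian_letter \<alpha> j" if "i < q" "j < q" for i j
        using that b sturmian_letter_cases[OF \<alpha>, of i] sturmian_letter_cases[OF \<alpha>, of j]
        by (auto simp: x_def over_def)
      have "sturmian_letter \<alpha> (n + k) < sturmian_letter \<alpha> k"
        using eq neq True letter by (intro sturmian_letter_first_difference \<alpha> n) auto
      then show ?thesis
        using sturmian_letter_cases[OF \<alpha>, of k] sturmian_letter_cases[OF \<alpha>, of "n + k"] b True
        by (auto simp: x_def over_def)
    qed
    then show ?thesis using eq by blast
  qed
  have "\<exists>\<beta>\<in>{real_of_int b..real_of_int b + 1}. beta_digit \<beta> = x"
    using a b m xm nonneg lex
    by (intro ex_beta_digit_eq[of x b m]) (auto simp: x_def over_def sturmian_letter_def)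
  then obtain \<beta> where \<beta>: "\<beta> \<in> {real_of_int b..real_of_int b + 1}" "beta_digit \<beta> = x" by blast
  \<comment> \<open>The last letter \<open>b\<close> is nonzero, so trimming trailing zeros stops
    exactly at length \<open>q\<close>, also when \<open>a = 0\<close>.\<close>
  have zero: "(\<forall>i\<ge>n. x i = 0) \<longleftrightarrow> q \<le> n" for n
  proof
    assume "\<forall>i\<ge>n. x i = 0"
    then have "\<not> n \<le> m" using xm a b by auto
    then show "q \<le> n" using m by simp
  qed (simp add: x_def)
  have "(LEAST n. q \<le> n) = q" by (rule Least_equality) auto
  then have "beta_expansion_of_1 \<beta> = Finite_word (map x [0..<q])"
    by (auto simp: beta_expansion_of_1_def \<beta> zero subsequence_def)
  moreover have "map x [0..<q] = [b] @ map (over a b) (central_word p q) @ [b]"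
  proof -
    \<comment> \<open>The ceiling word ends in 0 and the floor word in 1, so they are compared only
      on the first \<open>m\<close> letters; the final \<open>b\<close> comes from
      \<open>xm\<close>.\<close>
    have "1 # central_word p q = butlast (upper_christoffel_word p q)"
      using upper_christoffel_word_eq[OF pq(1,2)] by simp
    also have "\<dots> = map (upper_mechanical_word \<alpha>) [0..<m]"
      by (simp add: upper_christoffel_word_def m upper_mechanical_word_def \<alpha>_def mult.commute)
    also have "\<dots> = map (sturmian_letter \<alpha>) [0..<m]"
      using nonint m by (auto intro!: upper_mechanical_eq_sturmian_letter \<alpha> simp del: of_nat_Suc)
    finally have "map (over a b) (1 # central_word p q) = map (over a b) (map (sturmian_letter \<alpha>) [0..<m])"
      by simp
    also have "\<dots> = map x [0..<m]" using m by (simp add: x_def)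
    finally show ?thesis using xm m by (simp add: over_def)
  qed
  ultimately show ?thesis using \<beta> by auto
qed

section \<open>Choosing the function\<close>

text \<open>Makes the value at a rational point well defined: a base found for one reduced fraction
  serves every reduced fraction equal to it.\<close>

lemma coprime_fraction_unique:
  fixes p q p' q' :: nat
  assumes "coprime p q" "coprime p' q'" "0 < q" "0 < q'" "real p / real q = real p' / real q'"
  shows "p = p' \<and> q = q'"
proof -
  have "real (p * q') = real (p' * q)" using assms by (simp add: field_simps)
  then have eq: "p * q' = p' * q" by linarith
  have "q dvd q'" using assms(1) eq by (metis coprime_commute coprime_dvd_mult_right_iff dvd_triv_right)
  moreover have "q' dvd q" using assms(2) eq by (metis coprime_commute coprime_dvd_mult_right_iff dvd_triv_right)
  ultimately have "q = q'" by (rule dvd_antisym)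
  then show ?thesis using eq assms by simp
qed

theorem theorem2p4:
  fixes a b :: int
  assumes "0 \<le> a" and "a < b"
  shows "\<exists>f :: real \<Rightarrow> real.
    f \<in> {0<..1} \<rightarrow> {real_of_int b..real_of_int b + 1} \<and>
    f 1 = real_of_int b + 1 \<and>
    (\<forall>\<alpha>. 0 < \<alpha> \<and> \<alpha> < 1 \<and> \<alpha> \<notin> \<rat> \<longrightarrow>
      beta_expansion_of_1 (f \<alpha>) =
        Infinite_word ([b] \<frown> (over a b \<circ> characteristic_word \<alpha>))) \<and>
    (\<forall>p q :: nat. 0 < p \<and> p < q \<and> coprime p q \<longrightarrow>
      beta_expansion_of_1 (f (real p / real q)) =
        Finite_word ([b] @ map (over a b) (central_word p q) @ [b]))"
proof -
  \<comment> \<open>All demands on the value at a single \<alpha>, so that \<open>f\<close> can be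
    chosen pointwise.\<close>
  define Q where "Q \<alpha> \<beta> \<longleftrightarrow> \<beta> \<in> {real_of_int b..real_of_int b + 1} \<and>
      (\<alpha> = 1 \<longrightarrow> \<beta> = real_of_int b + 1) \<and>
      (0 < \<alpha> \<and> \<alpha> < 1 \<and> \<alpha> \<notin> \<rat> \<longrightarrow> beta_expansion_of_1 \<beta> =
        Infinite_word ([b] \<frown> (over a b \<circ> characteristic_word \<alpha>))) \<and>
      (\<forall>p q :: nat. 0 < p \<and> p < q \<and> coprime p q \<and> \<alpha> = real p / real q \<longrightarrow>
        beta_expansion_of_1 \<beta> = Finite_word ([b] @ map (over a b) (central_word p q) @ [b]))"
    for \<alpha> \<beta>
  have "\<exists>\<beta>. Q \<alpha> \<beta>" for \<alpha>
  proof (cases "\<exists>p q :: nat. 0 < p \<and> p < q \<and> coprime p q \<and> \<alpha> = real p / real q")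
    case True
    then obtain p q :: nat where pq: "0 < p" "p < q" "coprime p q" "\<alpha> = real p / real q" by blast
    obtain \<beta> where \<beta>: "\<beta> \<in> {real_of_int b..real_of_int b + 1}" "beta_expansion_of_1 \<beta> =
        Finite_word ([b] @ map (over a b) (central_word p q) @ [b])"
      using ex_beta_rational[OF assms pq(1-3)] by blast
    have "p' = p \<and> q' = q" if "0 < p'" "p' < q'" "coprime p' q'" "\<alpha> = real p' / real q'" for p' q' :: nat
      using that pq by (intro coprime_fraction_unique) auto
    moreover have "\<alpha> \<in> \<rat>" "\<alpha> \<noteq> 1" using pq by auto
    ultimately have "Q \<alpha> \<beta>" unfolding Q_def using \<beta> by blast
    then show ?thesis by blast
  next
    case notfrac: False
    show ?thesis
    proof (cases "0 < \<alpha> \<and> \<alpha> < 1 \<and> \<alpha> \<notin> \<rat>")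
      case True
      then show ?thesis
        unfolding Q_def using ex_beta_irrational[OF assms, of \<alpha>] notfrac by blast
    next
      case False
      \<comment> \<open>The value prescribed at 1 also serves as the default outside (0, 1).\<close>
      have "real_of_int b + 1 \<in> {real_of_int b..real_of_int b + 1}" by simp
      then have "Q \<alpha> (real_of_int b + 1)" unfolding Q_def using notfrac False by blast
      then show ?thesis by blast
    qed
  qed
  then obtain f where "\<And>\<alpha>. Q \<alpha> (f \<alpha>)" by metis
  then show ?thesis unfolding Q_def by (intro exI[of _ f]) blast
qed

end
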